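(* Let $n\ge 2$ and let $\rho\in M_n(\mathbb{C})$ be a density matrix with eigenvalues $\lambda_1,\dots,\lambda_n$ (counted with multiplicity), and let $\mathrm{VN}(\rho)=-\sum_{i=1}^n\lambda_i\ln\lambda_i$ be its von Neumann entropy. If $V_\rho=\{P_1,\dots,P_n\}''$ is a maximal context generated by the rank-one projections onto the vectors of an orthonormal basis with respect to which $\rho$ is diagonal, then $E_\rho(V_\rho)=\mathrm{VN}(\rho)$. Moreover, $$\mathrm{VN}(\rho)=\min\{E_\rho(V) : V \text{ a maximal context of } M_n\}.$$
   Context: $M_n = M_n(\mathbb{C})$ is the algebra of complex $n\times n$ matrices. A density matrix is a positive semidefinite matrix of trace $1$. A context is a commutative $*$-subalgebra $V\subseteq M_n$ containing the identity $I$, with $V\neq\mathbb{C}I$; $\mathcal{V}(M_n)$ denotes the set of all contexts, ordered by inclusion. Each context is $V=\mathbb{C}P_1+\dots+\mathbb{C}P_k$ for a unique (up to order) set of nonzero pairwise orthogonal projections with $P_1+\dots+P_k=I$ (its canonical projections); one writes $V=\{P_1,\dots,P_k\}''$. A context is maximal if it is maximal under inclusion, equivalently if it has $n$ canonical projections, all of rank one. The contextual entropy of $\rho$ is the function on $\mathcal{V}(M_n)$ given by $$E_\rho(V) = -\sum_{i=1}^k \mathrm{Tr}(\rho P_i)\ln \mathrm{Tr}(\rho P_i),\qquad V=\{P_1,\dots,P_k\}''.$$ Convention: $0\ln 0=0$. *)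

theory Defs
  imports
    "HOL-Computational_Algebra.Fundamental_Theorem_Algebra"
    "Jordan_Normal_Form.Schur_Decomposition"
begin

definition mat_trace :: "complex mat \<Rightarrow> complex" where
  "mat_trace A = (\<Sum>i<dim_row A. A $$ (i, i))"

definition hermitian_mat :: "complex mat \<Rightarrow> bool" where
  "hermitian_mat A \<longleftrightarrow> mat_adjoint A = A"

(* The order on complex numbers is the one of Complex_Order:
   0 \<le> z says that z is real and nonnegative. *)
definition psd_mat :: "nat \<Rightarrow> complex mat \<Rightarrow> bool" where
  "psd_mat n A \<longleftrightarrow> A \<in> carrier_mat n n \<and> hermitian_mat A \<and>
     (\<forall>v \<in> carrier_vec n. 0 \<le> (A *\<^sub>v v) \<bullet>c v)"

definition density_mat :: "nat \<Rightarrow> complex mat \<Rightarrow> bool" where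
  "density_mat n \<rho> \<longleftrightarrow> psd_mat n \<rho> \<and> mat_trace \<rho> = 1"

definition unital_star_subalgebra :: "nat \<Rightarrow> complex mat set \<Rightarrow> bool" where
  "unital_star_subalgebra n V \<longleftrightarrow>
     V \<subseteq> carrier_mat n n \<and> 1\<^sub>m n \<in> V \<and>
     (\<forall>A \<in> V. \<forall>B \<in> V. A + B \<in> V) \<and>
     (\<forall>c. \<forall>A \<in> V. c \<cdot>\<^sub>m A \<in> V) \<and>
     (\<forall>A \<in> V. \<forall>B \<in> V. A * B \<in> V) \<and>
     (\<forall>A \<in> V. mat_adjoint A \<in> V)"

definition is_context :: "nat \<Rightarrow> complex mat set \<Rightarrow> bool" where
  "is_context n V \<longleftrightarrow>
     unital_star_subalgebra n V \<and>
     (\<forall>A \<in> V. \<forall>B \<in> V. A * B = B * A) \<and>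
     V \<noteq> {c \<cdot>\<^sub>m 1\<^sub>m n | c. True}"

definition maximal_context :: "nat \<Rightarrow> complex mat set \<Rightarrow> bool" where
  "maximal_context n V \<longleftrightarrow>
     is_context n V \<and> (\<forall>W. is_context n W \<longrightarrow> V \<subseteq> W \<longrightarrow> W = V)"

definition projection_mat :: "nat \<Rightarrow> complex mat \<Rightarrow> bool" where
  "projection_mat n P \<longleftrightarrow> P \<in> carrier_mat n n \<and> P * P = P \<and> hermitian_mat P"

(* Matrices of size n are not a class instance of commutative monoids,
   so linear combinations over a finite set S are formed entrywise. *)
definition mat_lincomb :: "nat \<Rightarrow> (complex mat \<Rightarrow> complex) \<Rightarrow> complex mat set \<Rightarrow> complex mat" where
  "mat_lincomb n c S = mat n n (\<lambda>(i, j). \<Sum>P\<in>S. c P * P $$ (i, j))"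

(* For S = {P_1, ..., P_k}: the set C P_1 + ... + C P_k, written {P_1, ..., P_k}''. *)
definition generated_by :: "nat \<Rightarrow> complex mat set \<Rightarrow> complex mat set" where
  "generated_by n S = {mat_lincomb n c S | c. True}"

definition canonical_projections :: "nat \<Rightarrow> complex mat set \<Rightarrow> complex mat set \<Rightarrow> bool" where
  "canonical_projections n V S \<longleftrightarrow>
     finite S \<and>
     (\<forall>P \<in> S. projection_mat n P \<and> P \<noteq> 0\<^sub>m n n) \<and>
     (\<forall>P \<in> S. \<forall>Q \<in> S. P \<noteq> Q \<longrightarrow> P * Q = 0\<^sub>m n n) \<and>
     mat_lincomb n (\<lambda>_. 1) S = 1\<^sub>m n \<and>
     V = generated_by n S"

(* The convention 0 ln 0 = 0 holds here because of the factor 0. *)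
definition xlnx :: "real \<Rightarrow> real" where
  "xlnx x = x * ln x"

(* Only meaningful on contexts, where the canonical projections exist and are unique.
   Tr(\<rho> P) is real for Hermitian \<rho> and P; Re only changes the type. *)
definition contextual_entropy :: "nat \<Rightarrow> complex mat \<Rightarrow> complex mat set \<Rightarrow> real" where
  "contextual_entropy n \<rho> V =
     - (\<Sum>P \<in> (THE S. canonical_projections n V S). xlnx (Re (mat_trace (\<rho> * P))))"

(* proots (char_poly \<rho>) is the multiset of eigenvalues with algebraic multiplicity;
   they are real for Hermitian \<rho>. *)
definition von_neumann_entropy :: "complex mat \<Rightarrow> real" where
  "von_neumann_entropy \<rho> = - (\<Sum>a \<in># proots (char_poly \<rho>). xlnx (Re a))"

definition orthonormal_basis :: "nat \<Rightarrow> (nat \<Rightarrow> complex vec) \<Rightarrow> bool" where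
  "orthonormal_basis n u \<longleftrightarrow>
     (\<forall>i<n. u i \<in> carrier_vec n) \<and>
     (\<forall>i<n. \<forall>j<n. u i \<bullet>c u j = (if i = j then 1 else 0))"

definition mat_in_basis :: "nat \<Rightarrow> (nat \<Rightarrow> complex vec) \<Rightarrow> complex mat \<Rightarrow> complex mat" where
  "mat_in_basis n u A = mat n n (\<lambda>(i, j). (A *\<^sub>v u j) \<bullet>c u i)"

(* For a unit vector v, the orthogonal projection v v^* onto the line spanned by v. *)
definition vec_projection :: "complex vec \<Rightarrow> complex mat" where
  "vec_projection v = mat (dim_vec v) (dim_vec v) (\<lambda>(i, j). v $ i * conjugate (v $ j))"

end

(* A commuting family of matrices closed under adjoints is diagonal in some orthonormal basis:
   take a maximal orthonormal system of common eigenvectors; its complement is invariant, so if it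
   were nonzero it would contain a further one. Applied to a maximal context V this shows that V
   consists of all matrices U D U* (D diagonal) for a fixed unitary U, with canonical projections
   the projections onto the columns of U, so the entropy at V is minus the sum of x ln x over the
   diagonal of U* rho U. In an eigenbasis of rho these are the eigenvalues; in any other basis they
   are the image of the eigenvalues under a doubly stochastic matrix, and convexity of x ln x gives
   the inequality. *)
theory Submission
  imports Defs "Jordan_Normal_Form.Spectral_Radius"
begin

section \<open>Adjoints and isometries\<close>

text \<open>Write ^H for the adjoint. Subspaces are not handled as sets of vectors: a k-dimensional
  one is an n x k matrix F with F^H F = 1, vectors mostly become n x 1 matrices, and dimensions are
  compared through Tr(F F^H) = k. Most arguments thereby become reassociation of products, for which
  \<open>mult_mat_assoc\<close> carries dimension equations that rewriting can discharge.
  Diagonalization alone only places a context inside the full diagonal algebra of some U. Equality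
  comes from maximality, once that algebra is known to be a context, and this is where n >= 2
  enters. Conversely, the diagonal algebra is its own commutant, hence a maximal context, so the
  minimum is attained. The entropy is defined through \<open>THE\<close>, so uniqueness of the
  canonical projections has to be proved as well. Double stochasticity acts in two halves: rows
  summing to 1 supply the weights for Jensen, columns summing to 1 restore the sum over the
  eigenvalues.\<close>

lemma mult_mat_assoc:
  "dim_col A = dim_row B \<Longrightarrow> dim_col B = dim_row C \<Longrightarrow> (A * B) * C = A * (B * C)"
  by (rule assoc_mult_mat) auto

lemma index_mult_mat_sum:
  "i < dim_row A \<Longrightarrow> j < dim_col B \<Longrightarrow> dim_col A = dim_row B \<Longrightarrow>
    (A * B) $$ (i, j) = (\<Sum>k<dim_row B. A $$ (i, k) * B $$ (k, j))"
  by (simp add: scalar_prod_def lessThan_atLeast0)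

lemma mat_adjoint_dim [simp]:
  "dim_row (mat_adjoint A) = dim_col A" "dim_col (mat_adjoint A) = dim_row A"
  by (simp_all only: mat_adjoint_def mat_of_rows_carrier length_map cols_length)

lemma mat_adjoint_carrier [simp]:
  "mat_adjoint A \<in> carrier_mat n m \<longleftrightarrow> A \<in> carrier_mat m n"
  unfolding carrier_mat_def mem_Collect_eq mat_adjoint_dim by (rule conj_commute)

lemma mat_adjoint_index [simp]:
  fixes A :: "complex mat"
  shows "i < dim_col A \<Longrightarrow> j < dim_row A \<Longrightarrow> mat_adjoint A $$ (i, j) = cnj (A $$ (j, i))"
  by (simp add: mat_adjoint_def mat_of_rows_index)

lemma mat_adjoint_adjoint [simp]:
  fixes A :: "complex mat"
  shows "mat_adjoint (mat_adjoint A) = A"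
  by (rule eq_matI) auto

lemma mat_adjoint_mult:
  fixes A B :: "complex mat"
  assumes "dim_col A = dim_row B"
  shows "mat_adjoint (A * B) = mat_adjoint B * mat_adjoint A"
  using assms by (intro eq_matI) (auto simp: index_mult_mat_sum mult.commute simp del: index_mult_mat(1))

lemma mat_adjoint_zero [simp]: "mat_adjoint (0\<^sub>m n m :: complex mat) = 0\<^sub>m m n"
  by (rule eq_matI) auto

lemma mat_adjoint_smult:
  fixes A :: "complex mat"
  shows "mat_adjoint (c \<cdot>\<^sub>m A) = cnj c \<cdot>\<^sub>m mat_adjoint A"
  by (rule eq_matI) auto

lemma mat_adjoint_mat_diag: "mat_adjoint (mat_diag n d) = mat_diag n (\<lambda>i. cnj (d i))"
  by (rule eq_matI) (auto simp: mat_diag_def)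

lemma dim_mat_diag [simp]: "dim_row (mat_diag n d) = n" "dim_col (mat_diag n d) = n"
  by (simp_all add: mat_diag_def)

section \<open>Traces and the squared Frobenius norm\<close>

lemma mat_trace_mult_adjoint:
  "mat_trace (A * mat_adjoint A) = of_real (\<Sum>i<dim_row A. \<Sum>j<dim_col A. (cmod (A $$ (i, j)))\<^sup>2)"
  by (simp add: mat_trace_def index_mult_mat_sum complex_norm_square del: index_mult_mat(1) of_real_power)

lemma mat_trace_mult_comm:
  assumes "dim_row A = dim_col B" "dim_col A = dim_row B"
  shows "mat_trace (A * B) = mat_trace (B * A)"
  using assms
  by (simp add: mat_trace_def index_mult_mat_sum mult.commute del: index_mult_mat(1)) (rule sum.swap)

text \<open>By cyclicity Tr(A^H A) = Tr(A A^H), which is the sum of the squared moduli of all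
  entries.\<close>

lemma mult_adjoint_eq_0_iff:
  fixes A :: "complex mat"
  assumes "A \<in> carrier_mat n m"
  shows "mat_adjoint A * A = 0\<^sub>m m m \<longleftrightarrow> A = 0\<^sub>m n m"
proof
  assume z: "mat_adjoint A * A = 0\<^sub>m m m"
  have "mat_trace (A * mat_adjoint A) = mat_trace (mat_adjoint A * A)"
    by (rule mat_trace_mult_comm) auto
  also have "\<dots> = 0" unfolding z by (simp add: mat_trace_def)
  finally have "(\<Sum>i<n. \<Sum>j<m. (cmod (A $$ (i, j)))\<^sup>2) = 0"
    using assms unfolding mat_trace_mult_adjoint of_real_eq_0_iff by auto
  hence "\<forall>i<n. \<forall>j<m. A $$ (i, j) = 0"
    by (subst (asm) sum_nonneg_eq_0_iff, auto intro!: sum_nonneg simp: sum_nonneg_eq_0_iff)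
  thus "A = 0\<^sub>m n m" using assms by (intro eq_matI) auto
qed (use assms in auto)

text \<open>The columns form an orthonormal system of k vectors, and F F^H is the projection onto
  their span. The cases k = 0 (empty system), k = 1 (unit vector) and k = n (unitary matrix) all
  occur below.\<close>

definition isometry_mat :: "nat \<Rightarrow> nat \<Rightarrow> complex mat \<Rightarrow> bool" where
  "isometry_mat n k F \<longleftrightarrow> F \<in> carrier_mat n k \<and> mat_adjoint F * F = 1\<^sub>m k"

text \<open>The last clause is the cancellation law in the right-nested form to which
  \<open>mult_mat_assoc\<close> brings products.\<close>

lemma isometry_matD:
  assumes "isometry_mat n k F"
  shows "F \<in> carrier_mat n k" "dim_row F = n" "dim_col F = k" "mat_adjoint F * F = 1\<^sub>m k"
    "\<And>X. dim_row X = k \<Longrightarrow> mat_adjoint F * (F * X) = X"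
proof -
  show *: "F \<in> carrier_mat n k" "mat_adjoint F * F = 1\<^sub>m k"
    using assms unfolding isometry_mat_def by auto
  thus "dim_row F = n" "dim_col F = k" by auto
  show "mat_adjoint F * (F * X) = X" if "dim_row X = k" for X
  proof -
    have "mat_adjoint F * (F * X) = (mat_adjoint F * F) * X"
      by (rule mult_mat_assoc[symmetric]) (use * that in auto)
    also have "\<dots> = X" unfolding * by (rule left_mult_one_mat) (use that in auto)
    finally show ?thesis .
  qed
qed

lemma isometry_mat_mult:
  assumes "isometry_mat n k F" "isometry_mat k l G"
  shows "isometry_mat n l (F * G)"
proof -
  note F = isometry_matD[OF assms(1)] and G = isometry_matD[OF assms(2)]
  have "mat_adjoint (F * G) * (F * G) = mat_adjoint G * (mat_adjoint F * (F * G))"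
    using F(2,3) G(2,3) by (simp add: mat_adjoint_mult mult_mat_assoc)
  also have "\<dots> = 1\<^sub>m l" using F(5)[of G] G(2,4) by simp
  finally show ?thesis using F(1) G(1) unfolding isometry_mat_def by auto
qed

text \<open>The projection H = 1 - F F^H onto the complement has trace n - k. As H = H H^H, this
  trace is a sum of squares, so k is at most n without any appeal to linear independence.\<close>

lemma isometry_mat_le:
  assumes "isometry_mat n k F"
  shows "k \<le> n" "k = n \<Longrightarrow> F * mat_adjoint F = 1\<^sub>m n"
    "F * mat_adjoint F = 1\<^sub>m n \<Longrightarrow> k = n"
proof -
  note F = isometry_matD[OF assms]
  let ?P = "F * mat_adjoint F"
  define H where "H = 1\<^sub>m n - ?P"
  have H: "H \<in> carrier_mat n n" using F unfolding H_def by auto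
  have PP: "?P * ?P = ?P" using F by (simp add: mult_mat_assoc)
  have adjH: "mat_adjoint H = H"
  proof -
    have "mat_adjoint (1\<^sub>m n - ?P) = 1\<^sub>m n - mat_adjoint ?P"
      using F(1) by (intro eq_matI) (auto simp del: index_mult_mat(1))
    also have "mat_adjoint ?P = ?P" using F by (simp add: mat_adjoint_mult)
    finally show ?thesis unfolding H_def .
  qed
  have "H * H = H * 1\<^sub>m n - H * ?P"
    unfolding H_def using F by (intro mult_minus_distrib_mat) auto
  also have "H * ?P = ?P - ?P"
    using F PP unfolding H_def
    by (subst minus_mult_distrib_mat[of _ n n _ _ n]) auto
  also have "\<dots> = 0\<^sub>m n n" using F by auto
  finally have HH: "H * H = H" using H by auto
  have "mat_trace ?P = mat_trace (mat_adjoint F * F)"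
    using F by (intro mat_trace_mult_comm) auto
  hence trP: "mat_trace ?P = of_nat k" using F by (simp add: mat_trace_def)
  have "mat_trace H = (\<Sum>i<n. 1 - ?P $$ (i, i))"
    using F unfolding mat_trace_def H_def by (auto intro!: sum.cong simp del: index_mult_mat(1))
  also have "\<dots> = of_nat n - mat_trace ?P" using F by (simp add: mat_trace_def sum_subtractf)
  finally have trH: "mat_trace H = of_nat n - of_nat k" using trP by simp
  have "mat_trace H = of_real (\<Sum>i<n. \<Sum>j<n. (cmod (H $$ (i, j)))\<^sup>2)" (is "_ = of_real ?s")
    using mat_trace_mult_adjoint[of H] adjH HH H by simp
  moreover have "?s \<ge> 0" by (intro sum_nonneg) auto
  ultimately have "real n - real k \<ge> 0"
    using trH by (metis Re_complex_of_real complex_Re_of_nat minus_complex.simps(1))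
  thus "k \<le> n" by simp
  show "k = n \<Longrightarrow> ?P = 1\<^sub>m n"
    using F mat_mult_left_right_inverse[of "mat_adjoint F" n F] by auto
  show "?P = 1\<^sub>m n \<Longrightarrow> k = n" using trP by (simp add: mat_trace_def)
qed

definition hcat :: "'a mat \<Rightarrow> 'a mat \<Rightarrow> 'a mat" where
  "hcat F G = mat (dim_row F) (dim_col F + dim_col G)
     (\<lambda>(i, j). if j < dim_col F then F $$ (i, j) else G $$ (i, j - dim_col F))"

lemma hcat_dim [simp]: "dim_row (hcat F G) = dim_row F" "dim_col (hcat F G) = dim_col F + dim_col G"
  by (simp_all add: hcat_def)

lemma hcat_index:
  "i < dim_row F \<Longrightarrow> j < dim_col F \<Longrightarrow> hcat F G $$ (i, j) = F $$ (i, j)"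
  "i < dim_row F \<Longrightarrow> \<not> j < dim_col F \<Longrightarrow> j < dim_col F + dim_col G \<Longrightarrow>
    hcat F G $$ (i, j) = G $$ (i, j - dim_col F)"
  by (simp_all add: hcat_def)

lemma mult_hcat:
  fixes M F G :: "complex mat"
  assumes "dim_col M = dim_row F" "dim_row F = dim_row G"
  shows "M * hcat F G = hcat (M * F) (M * G)"
  using assms
  by (intro eq_matI) (auto simp: index_mult_mat_sum hcat_def simp del: index_mult_mat(1))

text \<open>The Gram matrix of the block matrix [F G] has the blocks F^H F, F^H G, G^H F and G^H G.
  One off-diagonal block is assumed to vanish; the other is its adjoint.\<close>

lemma isometry_hcat:
  assumes "isometry_mat n k F" "isometry_mat n l G" "mat_adjoint F * G = 0\<^sub>m k l"
  shows "isometry_mat n (k + l) (hcat F G)"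
proof -
  note F = isometry_matD[OF assms(1)] and G = isometry_matD[OF assms(2)]
  have GF: "mat_adjoint G * F = 0\<^sub>m l k"
    using arg_cong[OF assms(3), of mat_adjoint] F G by (simp add: mat_adjoint_mult)
  have entry: "(mat_adjoint A * B) $$ (i, j) = (\<Sum>a<n. cnj (A $$ (a, i)) * B $$ (a, j))"
    if "i < dim_col A" "j < dim_col B" "dim_row A = n" "dim_row B = n" for A B :: "complex mat" and i j
    using that by (subst index_mult_mat_sum) auto
  have "mat_adjoint (hcat F G) * hcat F G = 1\<^sub>m (k + l)"
  proof (rule eq_matI)
    fix i j assume "i < dim_row (1\<^sub>m (k + l) :: complex mat)" "j < dim_col (1\<^sub>m (k + l) :: complex mat)"
    hence i: "i < k + l" and j: "j < k + l" by auto
    let ?A = "if i < k then F else G" and ?B = "if j < k then F else G"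
    let ?i = "if i < k then i else i - k" and ?j = "if j < k then j else j - k"
    have "(mat_adjoint (hcat F G) * hcat F G) $$ (i, j) = (mat_adjoint ?A * ?B) $$ (?i, ?j)"
      using i j F G by (subst (1 2) entry) (auto simp: hcat_index intro!: sum.cong)
    also have "\<dots> = (if i = j then 1 else 0)"
      using i j F(4) G(4) assms(3) GF by auto
    finally show "(mat_adjoint (hcat F G) * hcat F G) $$ (i, j) = 1\<^sub>m (k + l) $$ (i, j)"
      using i j by simp
  qed (simp_all add: F(2,3) G(2,3))
  moreover have "hcat F G \<in> carrier_mat n (k + l)"
    by (rule carrier_matI) (simp_all add: F(2,3) G(2,3))
  ultimately show ?thesis unfolding isometry_mat_def by blast
qed

section \<open>Orthonormal bases of kernels\<close>

lemma normalize_column: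
  assumes X: "X \<in> carrier_mat n 1" and nz: "X \<noteq> 0\<^sub>m n 1"
  shows "\<exists>c. isometry_mat n 1 (c \<cdot>\<^sub>m X)"
proof -
  define s where "s = (\<Sum>a<n. (cmod (X $$ (a, 0)))\<^sup>2)"
  have XX: "mat_adjoint X * X = of_real s \<cdot>\<^sub>m 1\<^sub>m 1"
    using X by (intro eq_matI)
      (auto simp: index_mult_mat_sum s_def complex_norm_square mult.commute
        simp del: index_mult_mat(1) of_real_power)
  have "s \<ge> 0" unfolding s_def by (intro sum_nonneg) auto
  have "s \<noteq> 0"
  proof
    assume "s = 0"
    hence "mat_adjoint X * X = 0\<^sub>m 1 1" unfolding XX by auto
    with mult_adjoint_eq_0_iff[OF X] nz show False by auto
  qed
  let ?c = "complex_of_real (1 / sqrt s)"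
  have "mat_adjoint (?c \<cdot>\<^sub>m X) * (?c \<cdot>\<^sub>m X) = (?c * ?c * of_real s) \<cdot>\<^sub>m 1\<^sub>m 1"
    using X XX by (auto simp: mat_adjoint_smult mult_smult_distrib[of _ 1 n _ 1] mult_smult_assoc_mat[of _ 1 n _ 1])
  also have "?c * ?c * of_real s = 1"
    using \<open>s \<ge> 0\<close> \<open>s \<noteq> 0\<close> by (simp flip: of_real_mult)
  finally have "isometry_mat n 1 (?c \<cdot>\<^sub>m X)" using X unfolding isometry_mat_def by auto
  thus ?thesis by blast
qed

text \<open>F is an orthonormal system in the kernel with as many columns as possible. If a kernel
  vector X were not fixed by F F^H, the residual X - F F^H X would be a nonzero kernel vector
  orthogonal to F, and after normalization it could be adjoined.\<close>

lemma kernel_isometry: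
  fixes M :: "complex mat"
  assumes M: "M \<in> carrier_mat m n"
  obtains k F where "isometry_mat n k F" "M * F = 0\<^sub>m m k"
    "\<And>X. X \<in> carrier_mat n 1 \<Longrightarrow> M * X = 0\<^sub>m m 1 \<Longrightarrow> F * (mat_adjoint F * X) = X"
proof -
  define Q where "Q k \<longleftrightarrow> (\<exists>F. isometry_mat n k F \<and> M * F = 0\<^sub>m m k)" for k
  \<comment> \<open>The empty system starts the search; \<open>isometry_mat_le\<close> bounds it, so
    a greatest k exists.\<close>
  have "isometry_mat n 0 (0\<^sub>m n 0)" "M * 0\<^sub>m n 0 = 0\<^sub>m m 0"
    using M by (auto simp: isometry_mat_def)
  hence "Q 0" unfolding Q_def by blast
  moreover have bnd: "Q k \<Longrightarrow> k \<le> n" for k unfolding Q_def using isometry_mat_le(1) by blast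
  ultimately have "Q (Greatest Q)" by (blast intro: GreatestI_nat)
  moreover have mx: "\<not> Q (Greatest Q + 1)"
    using Greatest_le_nat[of Q "Greatest Q + 1" n] bnd by auto
  ultimately obtain k F where F: "isometry_mat n k F" and MF: "M * F = 0\<^sub>m m k" and nQ: "\<not> Q (k + 1)"
    unfolding Q_def by blast
  note F' = isometry_matD[OF F]
  show thesis
  proof (rule that[OF F MF], rule ccontr)
    fix X assume X: "X \<in> carrier_mat n 1" and MX: "M * X = 0\<^sub>m m 1"
      and ne: "F * (mat_adjoint F * X) \<noteq> X"
    let ?Y = "F * (mat_adjoint F * X)"
    define R where "R = X - ?Y"
    have R: "R \<in> carrier_mat n 1" using F' X unfolding R_def by auto
    have Y: "?Y \<in> carrier_mat n 1" using F' X by auto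
    have Rnz: "R \<noteq> 0\<^sub>m n 1"
    proof
      assume z: "R = 0\<^sub>m n 1"
      have "?Y = X"
      proof (rule eq_matI)
        fix i j assume ij: "i < dim_row X" "j < dim_col X"
        have "R $$ (i, j) = 0" using ij X unfolding z by auto
        thus "?Y $$ (i, j) = X $$ (i, j)"
          using ij X Y unfolding R_def by (auto simp del: index_mult_mat(1))
      qed (use X Y in auto)
      with ne show False by simp
    qed
    have "M * ?Y = (M * F) * (mat_adjoint F * X)"
      using F' X M by (simp add: mult_mat_assoc)
    also have "\<dots> = 0\<^sub>m m 1" unfolding MF using F' X by auto
    finally have MR: "M * R = 0\<^sub>m m 1"
      unfolding R_def by (subst mult_minus_distrib_mat[OF M X Y]) (simp add: MX)
    have "mat_adjoint F * R = mat_adjoint F * X - mat_adjoint F * ?Y"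
      unfolding R_def by (rule mult_minus_distrib_mat[OF _ X Y, of _ k]) (use F' in auto)
    also have "\<dots> = 0\<^sub>m k 1" using F' X by auto
    finally have FR: "mat_adjoint F * R = 0\<^sub>m k 1" .
    obtain c where c: "isometry_mat n 1 (c \<cdot>\<^sub>m R)" using normalize_column[OF R Rnz] by blast
    have "mat_adjoint F * (c \<cdot>\<^sub>m R) = 0\<^sub>m k 1"
      using FR R F' by (subst mult_smult_distrib[of _ k n _ 1]) auto
    from isometry_hcat[OF F c this] have 1: "isometry_mat n (k + 1) (hcat F (c \<cdot>\<^sub>m R))" .
    have "M * hcat F (c \<cdot>\<^sub>m R) = hcat (M * F) (M * (c \<cdot>\<^sub>m R))"
      using M F' R by (intro mult_hcat) auto
    also have "M * (c \<cdot>\<^sub>m R) = 0\<^sub>m m 1"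
      using MR R M by (subst mult_smult_distrib[of _ m n _ 1]) auto
    also have "hcat (M * F) (0\<^sub>m m 1) = 0\<^sub>m m (k + 1)"
      unfolding MF by (intro eq_matI) (auto simp: hcat_def)
    finally show False using 1 nQ unfolding Q_def by blast
  qed
qed

section \<open>Simultaneous diagonalization\<close>

text \<open>\<open>kernel_isometry\<close> applies to each column of X separately. The matrix
  version is what shows that a subspace is invariant, with X of the form B * F.\<close>

lemma kernel_isometry_mat:
  fixes M :: "complex mat"
  assumes M: "M \<in> carrier_mat m n"
  obtains k F where "isometry_mat n k F" "M * F = 0\<^sub>m m k"
    "\<And>X p. X \<in> carrier_mat n p \<Longrightarrow> M * X = 0\<^sub>m m p \<Longrightarrow> F * (mat_adjoint F * X) = X"
proof -
  obtain k F where F: "isometry_mat n k F" "M * F = 0\<^sub>m m k"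
    and ker: "\<And>X. X \<in> carrier_mat n 1 \<Longrightarrow> M * X = 0\<^sub>m m 1 \<Longrightarrow> F * (mat_adjoint F * X) = X"
    using kernel_isometry[OF M] by blast
  note F' = isometry_matD[OF F(1)]
  have "F * (mat_adjoint F * X) = X" if X: "X \<in> carrier_mat n p" and MX: "M * X = 0\<^sub>m m p" for X p
  proof (rule eq_matI)
    fix i j assume "i < dim_row X" "j < dim_col X"
    hence i: "i < n" and j: "j < p" using X by auto
    define c where "c = mat n 1 (\<lambda>(i, _). X $$ (i, j))"
    have c: "c \<in> carrier_mat n 1" unfolding c_def by simp
    have mult_c: "(N * c) $$ (a, 0) = (N * X) $$ (a, j)"
      if "N \<in> carrier_mat q n" "a < q" for N :: "complex mat" and q a
      using that X j by (simp add: index_mult_mat_sum c_def del: index_mult_mat(1))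
    have "M * c = 0\<^sub>m m 1"
    proof (rule eq_matI)
      fix a b assume "a < dim_row (0\<^sub>m m 1 :: complex mat)" "b < dim_col (0\<^sub>m m 1 :: complex mat)"
      hence ab: "a < m" "b = 0" by auto
      show "(M * c) $$ (a, b) = 0\<^sub>m m 1 $$ (a, b)"
        using mult_c[OF M ab(1)] ab j unfolding MX by (simp del: index_mult_mat(1))
    qed (use M c in auto)
    from ker[OF c this] have Pc: "(F * mat_adjoint F) * c = c"
      using F'(2,3) c by (simp add: mult_mat_assoc)
    have "(F * (mat_adjoint F * X)) $$ (i, j) = ((F * mat_adjoint F) * X) $$ (i, j)"
      using F'(2,3) X by (simp add: mult_mat_assoc del: index_mult_mat(1))
    also have "\<dots> = ((F * mat_adjoint F) * c) $$ (i, 0)"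
      by (rule mult_c[symmetric, of _ n]) (use F'(1) i in auto)
    also have "\<dots> = X $$ (i, j)" unfolding Pc using i by (simp add: c_def)
    finally show "(F * (mat_adjoint F * X)) $$ (i, j) = X $$ (i, j)" .
  qed (use F' X in auto)
  thus thesis using that[OF F] by blast
qed

section \<open>Compressions to invariant subspaces\<close>

definition compress :: "complex mat \<Rightarrow> complex mat \<Rightarrow> complex mat" where
  "compress F A = mat_adjoint F * (A * F)"

lemma compress_carrier:
  "F \<in> carrier_mat n k \<Longrightarrow> A \<in> carrier_mat n n \<Longrightarrow> compress F A \<in> carrier_mat k k"
  unfolding compress_def by (intro mult_carrier_mat[of _ k n]) auto

text \<open>The last assumption reads F F^H B F = B F: the column space of F is invariant under B.
  So F F^H may be dropped between the factors, and compressions of commuting matrices that leave the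
  space invariant commute.\<close>

lemma compress_mult:
  assumes "F \<in> carrier_mat n k" "A \<in> carrier_mat n n" "B \<in> carrier_mat n n"
    and "F * compress F B = B * F"
  shows "compress F A * compress F B = compress F (A * B)"
proof -
  have "compress F A * compress F B = mat_adjoint F * (A * (F * compress F B))"
    using assms(1-3) by (simp add: compress_def mult_mat_assoc)
  also have "\<dots> = compress F (A * B)"
    unfolding assms(4) using assms(1-3) by (simp add: compress_def mult_mat_assoc)
  finally show ?thesis .
qed

text \<open>An eigenspace of one member is invariant under all of the family, so it suffices to find
  the common eigenvector for the compressions to it.\<close>

lemma common_eigenvector:
  assumes "n > 0" "\<F> \<subseteq> carrier_mat n n" "\<And>A B. A \<in> \<F> \<Longrightarrow> B \<in> \<F> \<Longrightarrow> A * B = B * A"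
  shows "\<exists>x. isometry_mat n 1 x \<and> (\<forall>A\<in>\<F>. \<exists>\<mu>. A * x = \<mu> \<cdot>\<^sub>m x)"
  using assms
proof (induction n arbitrary: \<F> rule: less_induct)
  case (less n)
  show ?case
  \<comment> \<open>If all members are scalar, any unit vector works. Otherwise an eigenspace of a
    nonscalar member has dimension strictly between 0 and n, and the induction hypothesis applies
    there.\<close>
  proof (cases "\<forall>A\<in>\<F>. \<exists>\<mu>. A = \<mu> \<cdot>\<^sub>m 1\<^sub>m n")
    case True
    define x :: "complex mat" where "x = mat n 1 (\<lambda>(i, _). if i = 0 then 1 else 0)"
    have x: "x \<in> carrier_mat n 1" by (simp add: x_def)
    moreover have "mat_adjoint x * x = 1\<^sub>m 1"
      using less.prems(1)
      by (intro eq_matI) (auto simp: index_mult_mat_sum x_def if_distrib cong: if_cong simp del: index_mult_mat(1))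
    ultimately have "isometry_mat n 1 x" by (simp add: isometry_mat_def)
    moreover have "\<exists>\<mu>. A * x = \<mu> \<cdot>\<^sub>m x" if A: "A \<in> \<F>" for A
    proof -
      obtain \<mu> where \<mu>: "A = \<mu> \<cdot>\<^sub>m 1\<^sub>m n" using A True by blast
      show ?thesis unfolding \<mu> using x by (auto simp: mult_smult_assoc_mat[of _ n n _ 1])
    qed
    ultimately show ?thesis by blast
  next
    case False
    then obtain A where A: "A \<in> \<F>" and nonscalar: "\<And>\<mu>. A \<noteq> \<mu> \<cdot>\<^sub>m 1\<^sub>m n" by blast
    have carr: "B \<in> carrier_mat n n" if "B \<in> \<F>" for B using that less.prems(2) by blast
    note Ac = carr[OF A]
    obtain \<mu> v where v: "eigenvector A v \<mu>"
      using spectrum_non_empty[OF Ac less.prems(1)] unfolding spectrum_def eigenvalue_def by blast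
    define X where "X = mat n 1 (\<lambda>(i, _). v $ i)"
    have X: "X \<in> carrier_mat n 1" by (simp add: X_def)
    have vc: "v \<in> carrier_vec n" and vnz: "v \<noteq> 0\<^sub>v n" and Av: "A *\<^sub>v v = \<mu> \<cdot>\<^sub>v v"
      using v Ac unfolding eigenvector_def by auto
    have Xnz: "X \<noteq> 0\<^sub>m n 1"
    proof
      assume z: "X = 0\<^sub>m n 1"
      have "v $ i = 0" if "i < n" for i
        using arg_cong[OF z, of "\<lambda>Z. Z $$ (i, 0)"] that by (simp add: X_def)
      hence "v = 0\<^sub>v n" using vc by (intro eq_vecI) auto
      with vnz show False by simp
    qed
    have AX: "A * X = \<mu> \<cdot>\<^sub>m X"
    proof (rule eq_matI)
      fix i j assume "i < dim_row (\<mu> \<cdot>\<^sub>m X)" "j < dim_col (\<mu> \<cdot>\<^sub>m X)"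
      hence i: "i < n" and j: "j = 0" using X by auto
      have "(A * X) $$ (i, 0) = (A *\<^sub>v v) $ i"
        using i Ac vc by (simp add: X_def scalar_prod_def)
      thus "(A * X) $$ (i, j) = (\<mu> \<cdot>\<^sub>m X) $$ (i, j)"
        unfolding Av j using i vc by (simp add: X_def)
    qed (use Ac X in auto)
    define M where "M = A - \<mu> \<cdot>\<^sub>m 1\<^sub>m n"
    have M: "M \<in> carrier_mat n n" unfolding M_def by (rule minus_carrier_mat) simp
    have MY: "M * Y = A * Y - \<mu> \<cdot>\<^sub>m Y" if "Y \<in> carrier_mat n p" for Y p
      unfolding M_def using that Ac
      by (simp add: minus_mult_distrib_mat[of _ n n _ _ p] mult_smult_assoc_mat[of _ n n _ p])
    obtain k F where F: "isometry_mat n k F" "M * F = 0\<^sub>m n k"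
      and ker: "\<And>X p. X \<in> carrier_mat n p \<Longrightarrow> M * X = 0\<^sub>m n p \<Longrightarrow> F * (mat_adjoint F * X) = X"
      using kernel_isometry_mat[OF M] by blast
    note F' = isometry_matD[OF F(1)]
    have "k \<noteq> 0"
    proof
      assume k: "k = 0"
      have "M * X = 0\<^sub>m n 1" unfolding MY[OF X] AX using X by auto
      from ker[OF X this] have "X = F * (mat_adjoint F * X)" ..
      also have "\<dots> = 0\<^sub>m n 1"
        using F'(2,3) X k by (intro eq_matI) (simp_all add: scalar_prod_def)
      finally show False using Xnz by simp
    qed
    moreover have "k \<noteq> n"
    proof
      assume k: "k = n"
      have "M = M * (F * mat_adjoint F)" using isometry_mat_le(2)[OF F(1) k] M by simp
      also have "\<dots> = (M * F) * mat_adjoint F" using F' M by (simp add: mult_mat_assoc)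
      also have "\<dots> = 0\<^sub>m n n" unfolding F(2) using F'(1) k by simp
      finally have M0: "M = 0\<^sub>m n n" .
      have "A = \<mu> \<cdot>\<^sub>m 1\<^sub>m n"
      proof (rule eq_matI)
        fix i j assume "i < dim_row (\<mu> \<cdot>\<^sub>m 1\<^sub>m n)" "j < dim_col (\<mu> \<cdot>\<^sub>m 1\<^sub>m n)"
        hence ij: "i < n" "j < n" by auto
        have "M $$ (i, j) = 0" using ij M0 by simp
        thus "A $$ (i, j) = (\<mu> \<cdot>\<^sub>m 1\<^sub>m n) $$ (i, j)" using ij Ac unfolding M_def by simp
      qed (use Ac in auto)
      with nonscalar show False by blast
    qed
    ultimately have k: "0 < k" "k < n" using isometry_mat_le(1)[OF F(1)] by auto
    have AF: "A * F = \<mu> \<cdot>\<^sub>m F"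
    proof (rule eq_matI)
      fix i j assume "i < dim_row (\<mu> \<cdot>\<^sub>m F)" "j < dim_col (\<mu> \<cdot>\<^sub>m F)"
      hence ij: "i < n" "j < k" using F' by auto
      have "(A * F - \<mu> \<cdot>\<^sub>m F) $$ (i, j) = 0" using F(2) ij unfolding MY[OF F'(1)] by simp
      thus "(A * F) $$ (i, j) = (\<mu> \<cdot>\<^sub>m F) $$ (i, j)"
        using ij F'(2,3) Ac by (simp del: index_mult_mat(1))
    qed (use Ac F' in auto)
    \<comment> \<open>B commutes with A and hence maps the kernel of A - \<mu> into itself;
      \<open>ker\<close> then says that F F^H fixes B * F.\<close>
    have inv: "F * compress F B = B * F" if B: "B \<in> \<F>" for B
      unfolding compress_def
    proof (rule ker)
      show BF: "B * F \<in> carrier_mat n k" using carr[OF B] F'(1) by auto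
      have "A * (B * F) = (A * B) * F" using Ac carr[OF B] F'(2) by (simp add: mult_mat_assoc)
      also have "\<dots> = (B * A) * F" using less.prems(3)[OF A B] by simp
      also have "\<dots> = B * (A * F)" using Ac carr[OF B] F'(2) by (simp add: mult_mat_assoc)
      also have "\<dots> = \<mu> \<cdot>\<^sub>m (B * F)" unfolding AF using carr[OF B] F'(1) by (rule mult_smult_distrib)
      finally show "M * (B * F) = 0\<^sub>m n k" unfolding MY[OF BF] using BF by auto
    qed
    have "compress F ` \<F> \<subseteq> carrier_mat k k"
      using compress_carrier[OF F'(1)] carr by blast
    moreover have "C * D = D * C" if CD: "C \<in> compress F ` \<F>" "D \<in> compress F ` \<F>" for C D
    proof -
      obtain B B' where "B \<in> \<F>" "C = compress F B" "B' \<in> \<F>" "D = compress F B'"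
        using CD by blast
      thus ?thesis using compress_mult[OF F'(1) carr carr inv] less.prems(3) by metis
    qed
    ultimately obtain x where x: "isometry_mat k 1 x"
      and ev: "\<And>C. C \<in> compress F ` \<F> \<Longrightarrow> \<exists>\<mu>. C * x = \<mu> \<cdot>\<^sub>m x"
      using less.IH[OF k(2,1), of "compress F ` \<F>"] by blast
    note x' = isometry_matD[OF x]
    have "\<exists>\<mu>. B * (F * x) = \<mu> \<cdot>\<^sub>m (F * x)" if B: "B \<in> \<F>" for B
    proof -
      obtain \<nu> where \<nu>: "compress F B * x = \<nu> \<cdot>\<^sub>m x" using ev B by blast
      have "B * (F * x) = (F * compress F B) * x"
        unfolding inv[OF B] using carr[OF B] F'(2,3) x'(2) by (simp add: mult_mat_assoc)
      also have "\<dots> = F * (compress F B * x)"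
        by (rule mult_mat_assoc) (use F'(2,3) x'(2) carr[OF B] in \<open>auto simp: compress_def\<close>)
      also have "\<dots> = \<nu> \<cdot>\<^sub>m (F * x)" unfolding \<nu> by (rule mult_smult_distrib[OF F'(1) x'(1)])
      finally show ?thesis by blast
    qed
    with isometry_mat_mult[OF F(1) x] show ?thesis by blast
  qed
qed

theorem simultaneous_diagonalization:
  assumes carr: "\<F> \<subseteq> carrier_mat n n"
    and comm: "\<And>A B. A \<in> \<F> \<Longrightarrow> B \<in> \<F> \<Longrightarrow> A * B = B * A"
    and star: "\<And>A. A \<in> \<F> \<Longrightarrow> mat_adjoint A \<in> \<F>"
  obtains U where "isometry_mat n n U" "\<And>A. A \<in> \<F> \<Longrightarrow> \<exists>d. A * U = U * mat_diag n d"
proof -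
  define Q where "Q k \<longleftrightarrow> (\<exists>U. isometry_mat n k U \<and> (\<forall>A\<in>\<F>. \<exists>d. A * U = U * mat_diag k d))" for k
  have c: "A \<in> carrier_mat n n" if "A \<in> \<F>" for A using that carr by blast
  have "isometry_mat n 0 (0\<^sub>m n 0)" by (auto simp: isometry_mat_def)
  moreover have "A * 0\<^sub>m n 0 = 0\<^sub>m n 0 * mat_diag 0 d" if "A \<in> \<F>" for A d
    using c[OF that] by (intro eq_matI) auto
  ultimately have "Q 0" unfolding Q_def by blast
  moreover have bnd: "Q k \<Longrightarrow> k \<le> n" for k unfolding Q_def using isometry_mat_le(1) by blast
  ultimately have "Q (Greatest Q)" by (blast intro: GreatestI_nat)
  moreover have mx: "\<not> Q (Greatest Q + 1)"
    using Greatest_le_nat[of Q "Greatest Q + 1" n] bnd by auto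
  ultimately obtain k U where U: "isometry_mat n k U"
    and diag: "\<And>A. A \<in> \<F> \<Longrightarrow> \<exists>d. A * U = U * mat_diag k d" and nQ: "\<not> Q (k + 1)"
    unfolding Q_def by blast
  note U' = isometry_matD[OF U]
  have "k = n"
  proof (rule ccontr)
    assume kn: "k \<noteq> n"
    \<comment> \<open>The orthogonal complement of the columns of U is the kernel of U^H; G is an
      orthonormal basis of it.\<close>
    have "mat_adjoint U \<in> carrier_mat k n" using U' by simp
    from kernel_isometry_mat[OF this] obtain l G where G: "isometry_mat n l G"
      and UG: "mat_adjoint U * G = 0\<^sub>m k l"
      and ker: "\<And>X p. X \<in> carrier_mat n p \<Longrightarrow> mat_adjoint U * X = 0\<^sub>m k p \<Longrightarrow>
        G * (mat_adjoint G * X) = X"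
      by blast
    note G' = isometry_matD[OF G]
    have l: "l > 0"
    proof (rule ccontr)
      assume l: "\<not> l > 0"
      \<comment> \<open>R projects onto the complement, so U^H R = 0. With l = 0 this forces R = 0,
        hence U U^H = 1, and comparing traces gives k = n.\<close>
      define R where "R = 1\<^sub>m n - U * mat_adjoint U"
      have UU: "U * mat_adjoint U \<in> carrier_mat n n" using U' by auto
      have R: "R \<in> carrier_mat n n" unfolding R_def by (rule minus_carrier_mat[OF UU])
      have "mat_adjoint U * R = mat_adjoint U * 1\<^sub>m n - mat_adjoint U * (U * mat_adjoint U)"
        unfolding R_def by (rule mult_minus_distrib_mat[of _ k n _ n]) (use U' in auto)
      also have "\<dots> = 0\<^sub>m k n" using U'(1,3,5) by auto
      finally have "R = G * (mat_adjoint G * R)" using ker[OF R] by simp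
      also have "\<dots> = 0\<^sub>m n n"
        using G'(2,3) R l by (intro eq_matI) (simp_all add: scalar_prod_def)
      finally have R0: "R = 0\<^sub>m n n" .
      have "U * mat_adjoint U = 1\<^sub>m n"
      proof (rule eq_matI)
        fix i j assume "i < dim_row (1\<^sub>m n :: complex mat)" "j < dim_col (1\<^sub>m n :: complex mat)"
        hence ij: "i < n" "j < n" by auto
        have "R $$ (i, j) = 0" using R0 ij by simp
        thus "(U * mat_adjoint U) $$ (i, j) = 1\<^sub>m n $$ (i, j)"
          using ij U'(2,3) unfolding R_def by (simp del: index_mult_mat(1))
      qed (use U' in auto)
      with isometry_mat_le(3)[OF U] kn show False by blast
    qed
    \<comment> \<open>Closure under adjoints enters here: the adjoint of A is also diagonal on U, so
      U^H A G = (A^H U)^H G = D^H U^H G = 0, and A preserves the complement.\<close>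
    have inv: "G * compress G A = A * G" if A: "A \<in> \<F>" for A
      unfolding compress_def
    proof (rule ker)
      show "A * G \<in> carrier_mat n l" using c[OF A] G'(1) by auto
      obtain d where d: "mat_adjoint A * U = U * mat_diag k d" using diag[OF star[OF A]] by blast
      have "mat_adjoint U * (A * G) = mat_adjoint (mat_adjoint A * U) * G"
        using c[OF A] U'(2) G'(2) by (simp add: mat_adjoint_mult mult_mat_assoc)
      also have "\<dots> = mat_adjoint (mat_diag k d) * (mat_adjoint U * G)"
        unfolding d using U'(2,3) G'(2) by (simp add: mat_adjoint_mult mult_mat_assoc)
      also have "\<dots> = 0\<^sub>m k l" unfolding UG by (rule right_mult_zero_mat) simp
      finally show "mat_adjoint U * (A * G) = 0\<^sub>m k l" .
    qed
    have "compress G ` \<F> \<subseteq> carrier_mat l l"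
      using compress_carrier[OF G'(1)] c by blast
    moreover have "C * D = D * C" if CD: "C \<in> compress G ` \<F>" "D \<in> compress G ` \<F>" for C D
    proof -
      obtain B B' where "B \<in> \<F>" "C = compress G B" "B' \<in> \<F>" "D = compress G B'"
        using CD by blast
      thus ?thesis using compress_mult[OF G'(1) c c inv] comm by metis
    qed
    ultimately obtain x where x: "isometry_mat l 1 x"
      and ev: "\<And>C. C \<in> compress G ` \<F> \<Longrightarrow> \<exists>\<mu>. C * x = \<mu> \<cdot>\<^sub>m x"
      using common_eigenvector[OF l, of "compress G ` \<F>"] by blast
    note x' = isometry_matD[OF x]
    define y where "y = G * x"
    have y: "isometry_mat n 1 y" unfolding y_def by (rule isometry_mat_mult[OF G x])
    note y' = isometry_matD[OF y]
    have "mat_adjoint U * y = (mat_adjoint U * G) * x"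
      unfolding y_def using U'(2) G'(2,3) x'(2) by (simp add: mult_mat_assoc)
    also have "\<dots> = 0\<^sub>m k 1" unfolding UG by (rule left_mult_zero_mat[OF x'(1)])
    finally have Uy: "isometry_mat n (k + 1) (hcat U y)" by (rule isometry_hcat[OF U y])
    have "\<exists>d. A * hcat U y = hcat U y * mat_diag (k + 1) d" if A: "A \<in> \<F>" for A
    proof -
      obtain d where d: "A * U = U * mat_diag k d" using diag[OF A] by blast
      obtain \<nu> where \<nu>: "compress G A * x = \<nu> \<cdot>\<^sub>m x" using ev A by blast
      have "A * y = (G * compress G A) * x"
        unfolding inv[OF A] y_def using c[OF A] G'(2,3) x'(2) by (simp add: mult_mat_assoc)
      also have "\<dots> = G * (compress G A * x)"
        by (rule mult_mat_assoc) (use G'(2,3) x'(2) c[OF A] in \<open>auto simp: compress_def\<close>)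
      also have "\<dots> = \<nu> \<cdot>\<^sub>m y" unfolding \<nu> y_def by (rule mult_smult_distrib[OF G'(1) x'(1)])
      finally have Ay: "A * y = \<nu> \<cdot>\<^sub>m y" .
      have "A * hcat U y = hcat (U * mat_diag k d) (\<nu> \<cdot>\<^sub>m y)"
        unfolding d[symmetric] Ay[symmetric] by (rule mult_hcat) (use c[OF A] U'(2) y'(2) in auto)
      also have "\<dots> = hcat U y * mat_diag (k + 1) (\<lambda>j. if j < k then d j else \<nu>)"
        unfolding mat_diag_mult_right[OF U'(1)] mat_diag_mult_right[OF isometry_matD(1)[OF Uy]]
        using U'(2,3) y'(2,3) by (intro eq_matI) (auto simp: hcat_def)
      finally show ?thesis by blast
    qed
    with Uy nQ show False unfolding Q_def by blast
  qed
  with that[of U] U diag show thesis by blast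
qed

section \<open>Maximal contexts and their canonical projections\<close>

definition unitary_diag :: "nat \<Rightarrow> complex mat \<Rightarrow> (nat \<Rightarrow> complex) \<Rightarrow> complex mat" where
  "unitary_diag n U d = U * (mat_diag n d * mat_adjoint U)"

definition column_projections :: "nat \<Rightarrow> complex mat \<Rightarrow> complex mat set" where
  "column_projections n U = (\<lambda>i. vec_projection (col U i)) ` {..<n}"

lemma unitary_diag_carrier:
  "U \<in> carrier_mat n n \<Longrightarrow> unitary_diag n U d \<in> carrier_mat n n"
  unfolding unitary_diag_def by (intro mult_carrier_mat[of _ n n]) auto

lemma unitary_diag_index:
  assumes "U \<in> carrier_mat n n" "a < n" "b < n"
  shows "unitary_diag n U d $$ (a, b) = (\<Sum>i<n. d i * (U $$ (a, i) * cnj (U $$ (b, i))))"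
proof -
  have "mat_diag n d * mat_adjoint U = mat n n (\<lambda>(i, j). d i * mat_adjoint U $$ (i, j))"
    by (rule mat_diag_mult_left) (use assms in auto)
  thus ?thesis using assms unfolding unitary_diag_def
    by (simp add: index_mult_mat_sum mult.left_commute del: index_mult_mat(1))
qed

lemma unitary_diag_cong:
  assumes "U \<in> carrier_mat n n" "\<And>i. i < n \<Longrightarrow> d i = e i"
  shows "unitary_diag n U d = unitary_diag n U e"
proof -
  have "mat_diag n d = mat_diag n e"
    by (rule eq_matI) (auto simp: mat_diag_def assms(2))
  thus ?thesis by (simp add: unitary_diag_def)
qed

lemma unitary_diag_add:
  assumes "U \<in> carrier_mat n n"
  shows "unitary_diag n U d + unitary_diag n U e = unitary_diag n U (\<lambda>i. d i + e i)"
  using carrier_matD[OF unitary_diag_carrier[OF assms]] assms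
  by (intro eq_matI) (simp_all add: unitary_diag_index sum.distrib distrib_right)

lemma unitary_diag_smult:
  assumes "U \<in> carrier_mat n n"
  shows "c \<cdot>\<^sub>m unitary_diag n U d = unitary_diag n U (\<lambda>i. c * d i)"
  using carrier_matD[OF unitary_diag_carrier[OF assms]] assms
  by (intro eq_matI) (simp_all add: unitary_diag_index sum_distrib_left mult.assoc)

lemma unitary_diag_adjoint:
  assumes "U \<in> carrier_mat n n"
  shows "mat_adjoint (unitary_diag n U d) = unitary_diag n U (\<lambda>i. cnj (d i))"
  using assms by (simp add: unitary_diag_def mat_adjoint_mult mat_adjoint_mat_diag mult_mat_assoc)

lemma unitary_diag_mult:
  assumes "isometry_mat n n U"
  shows "unitary_diag n U d * unitary_diag n U e = unitary_diag n U (\<lambda>i. d i * e i)"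
proof -
  note U = isometry_matD[OF assms]
  have "unitary_diag n U d * unitary_diag n U e =
      U * (mat_diag n d * (mat_adjoint U * (U * (mat_diag n e * mat_adjoint U))))"
    using U(2,3) by (simp add: unitary_diag_def mult_mat_assoc)
  also have "mat_adjoint U * (U * (mat_diag n e * mat_adjoint U)) = mat_diag n e * mat_adjoint U"
    by (rule U(5)) simp
  also have "mat_diag n d * (mat_diag n e * mat_adjoint U) = (mat_diag n d * mat_diag n e) * mat_adjoint U"
    by (rule mult_mat_assoc[symmetric]) (use U(3) in auto)
  finally show ?thesis by (simp add: unitary_diag_def)
qed

lemma unitary_diag_one:
  assumes "isometry_mat n n U"
  shows "unitary_diag n U (\<lambda>_. 1) = 1\<^sub>m n"
  using isometry_mat_le(2)[OF assms] isometry_matD(1)[OF assms] by (simp add: unitary_diag_def)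

lemma compress_unitary_diag:
  assumes "isometry_mat n n U"
  shows "compress U (unitary_diag n U d) = mat_diag n d"
proof -
  note U = isometry_matD[OF assms]
  have "compress U (unitary_diag n U d) =
      mat_adjoint U * (U * (mat_diag n d * (mat_adjoint U * U)))"
    using U(2,3) by (simp add: compress_def unitary_diag_def mult_mat_assoc)
  also have "\<dots> = mat_diag n d" using U(4) U(5)[of "mat_diag n d"]
    by (simp add: right_mult_one_mat[of _ n n])
  finally show ?thesis .
qed

lemma unitary_diag_compress:
  assumes "isometry_mat n n U" "A \<in> carrier_mat n n" "compress U A = mat_diag n d"
  shows "A = unitary_diag n U d"
proof -
  note U = isometry_matD[OF assms(1)]
  note UU = isometry_mat_le(2)[OF assms(1) refl]
  have "A = (U * mat_adjoint U) * (A * (U * mat_adjoint U))" unfolding UU using assms(2) by simp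
  also have "\<dots> = U * (compress U A * mat_adjoint U)"
    using U(2,3) assms(2) by (simp add: compress_def mult_mat_assoc)
  finally show ?thesis unfolding assms(3) unitary_diag_def .
qed

lemma unitary_diag_inject:
  assumes "isometry_mat n n U" "unitary_diag n U d = unitary_diag n U e" "i < n"
  shows "d i = e i"
proof -
  have "mat_diag n d $$ (i, i) = mat_diag n e $$ (i, i)"
    using assms(2) by (simp flip: compress_unitary_diag[OF assms(1)])
  thus ?thesis using assms(3) by (simp add: mat_diag_def)
qed

text \<open>In the basis of the columns these projections have indicator functions on the diagonal,
  so their algebra reduces to pointwise products of functions on indices.\<close>

lemma vec_projection_col:
  assumes "U \<in> carrier_mat n n" "i < n"
  shows "vec_projection (col U i) = unitary_diag n U (\<lambda>j. if j = i then 1 else 0)"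
  using carrier_matD[OF unitary_diag_carrier[OF assms(1)]] assms
  by (intro eq_matI)
    (simp_all add: vec_projection_def unitary_diag_index if_distrib[of "\<lambda>x. x * _"] cong: if_cong)

text \<open>Canonical projections form a set, while the computations run over indices. Injectivity
  ensures that no two summands collapse.\<close>

lemma inj_on_column_projections:
  assumes "isometry_mat n n U"
  shows "inj_on (\<lambda>i. vec_projection (col U i)) {..<n}"
proof (rule inj_onI)
  fix i j assume ij: "i \<in> {..<n}" "j \<in> {..<n}"
    and eq: "vec_projection (col U i) = vec_projection (col U j)"
  from eq have "(if i = i then 1 else 0 :: complex) = (if i = j then 1 else 0)"
    using ij unfolding vec_projection_col[OF isometry_matD(1)[OF assms] ij(1)[simplified]]
      vec_projection_col[OF isometry_matD(1)[OF assms] ij(2)[simplified]]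
    by (intro unitary_diag_inject[OF assms]) auto
  thus "i = j" by (simp split: if_splits)
qed

lemma mat_lincomb_column_projections:
  assumes "isometry_mat n n U"
  shows "mat_lincomb n c (column_projections n U) = unitary_diag n U (\<lambda>i. c (vec_projection (col U i)))"
proof -
  note U = isometry_matD[OF assms]
  have "(\<Sum>P\<in>column_projections n U. c P * P $$ (a, b)) =
      (\<Sum>i<n. c (vec_projection (col U i)) * vec_projection (col U i) $$ (a, b))" for a b
    unfolding column_projections_def by (simp add: sum.reindex[OF inj_on_column_projections[OF assms]])
  moreover have "vec_projection (col U i) $$ (a, b) = U $$ (a, i) * cnj (U $$ (b, i))"
    if "a < n" "b < n" "i < n" for a b i
    using that U(2,3) by (simp add: vec_projection_def)
  ultimately show ?thesis
    using carrier_matD[OF unitary_diag_carrier[OF U(1)]] U(1)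
    by (intro eq_matI) (simp_all add: mat_lincomb_def unitary_diag_index)
qed

lemma generated_by_column_projections:
  assumes "isometry_mat n n U"
  shows "generated_by n (column_projections n U) = range (unitary_diag n U)"
proof (intro equalityI subsetI)
  fix A assume "A \<in> range (unitary_diag n U)"
  then obtain d where A: "A = unitary_diag n U d" by blast
  let ?P = "\<lambda>i. vec_projection (col U i)"
  \<comment> \<open>Coefficients in \<open>mat_lincomb\<close> are indexed by matrices, so d is
    transported along the inverse of the map from indices to projections.\<close>
  have "A = mat_lincomb n (d \<circ> inv_into {..<n} ?P) (column_projections n U)"
    unfolding A mat_lincomb_column_projections[OF assms]
    by (rule unitary_diag_cong[OF isometry_matD(1)[OF assms]])
      (simp add: inv_into_f_f[OF inj_on_column_projections[OF assms]])
  thus "A \<in> generated_by n (column_projections n U)" unfolding generated_by_def by blast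
qed (auto simp: generated_by_def mat_lincomb_column_projections[OF assms])

lemma canonical_column_projections:
  assumes "isometry_mat n n U"
  shows "canonical_projections n (range (unitary_diag n U)) (column_projections n U)"
  unfolding canonical_projections_def
proof (intro conjI ballI impI)
  note U = isometry_matD(1)[OF assms]
  have zero: "unitary_diag n U (\<lambda>_. 0) = 0\<^sub>m n n"
    using carrier_matD[OF unitary_diag_carrier[OF U]] U
    by (intro eq_matI) (simp_all add: unitary_diag_index)
  show "finite (column_projections n U)" by (simp add: column_projections_def)
  show "mat_lincomb n (\<lambda>_. 1) (column_projections n U) = 1\<^sub>m n"
    by (simp add: mat_lincomb_column_projections[OF assms] unitary_diag_one[OF assms])
  show "range (unitary_diag n U) = generated_by n (column_projections n U)"
    by (rule generated_by_column_projections[OF assms, symmetric])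
  fix P assume "P \<in> column_projections n U"
  then obtain i where i: "i < n" and "P = vec_projection (col U i)"
    unfolding column_projections_def by blast
  hence P: "P = unitary_diag n U (\<lambda>j. if j = i then 1 else 0)" using vec_projection_col[OF U] by simp
  have "P * P = P"
    unfolding P unitary_diag_mult[OF assms] by (rule unitary_diag_cong[OF U]) simp
  moreover have "mat_adjoint P = P"
    unfolding P unitary_diag_adjoint[OF U] by (rule unitary_diag_cong[OF U]) simp
  ultimately show "projection_mat n P"
    using unitary_diag_carrier[OF U] unfolding projection_mat_def hermitian_mat_def P by simp
  show "P \<noteq> 0\<^sub>m n n"
    using unitary_diag_inject[OF assms _ i, of "\<lambda>j. if j = i then 1 else 0" "\<lambda>_. 0"]
    unfolding P zero by auto
  fix Q assume "Q \<in> column_projections n U" and ne: "P \<noteq> Q"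
  then obtain j where j: "j < n" and "Q = vec_projection (col U j)"
    unfolding column_projections_def by blast
  hence Q: "Q = unitary_diag n U (\<lambda>l. if l = j then 1 else 0)" using vec_projection_col[OF U] by simp
  have "i \<noteq> j" using ne P Q by auto
  thus "P * Q = 0\<^sub>m n n"
    unfolding P Q unitary_diag_mult[OF assms] zero[symmetric]
    by (intro unitary_diag_cong[OF U]) simp
qed

text \<open>Orthogonality kills every term but the one at P, so multiplying by P from either side
  reads off its coefficient.\<close>

lemma mat_lincomb_mult_projection:
  assumes S: "finite S" "\<And>Q. Q \<in> S \<Longrightarrow> Q \<in> carrier_mat n n" "\<And>Q. Q \<in> S \<Longrightarrow> Q * Q = Q"
    and orth: "\<And>Q R. Q \<in> S \<Longrightarrow> R \<in> S \<Longrightarrow> Q \<noteq> R \<Longrightarrow> Q * R = 0\<^sub>m n n"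
    and P: "P \<in> S"
  shows "mat_lincomb n c S * P = c P \<cdot>\<^sub>m P" "P * mat_lincomb n c S = c P \<cdot>\<^sub>m P"
proof -
  note Pc = S(2)[OF P]
  have entry: "(\<Sum>k<n. Q $$ (i, k) * R $$ (k, j)) = (if Q = R then R $$ (i, j) else 0)"
    if "Q \<in> S" "R \<in> S" "i < n" "j < n" for Q R i j
  proof -
    have "(\<Sum>k<n. Q $$ (i, k) * R $$ (k, j)) = (Q * R) $$ (i, j)"
      using that S(2)[OF that(1)] S(2)[OF that(2)] by (simp add: index_mult_mat_sum del: index_mult_mat(1))
    also have "\<dots> = (if Q = R then R $$ (i, j) else 0)"
      using that S(3)[OF that(2)] orth[OF that(1,2)] by (simp del: index_mult_mat(1))
    finally show ?thesis .
  qed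
  have L: "mat_lincomb n c S \<in> carrier_mat n n" by (simp add: mat_lincomb_def)
  show "mat_lincomb n c S * P = c P \<cdot>\<^sub>m P"
  proof (rule eq_matI)
    fix i j assume "i < dim_row (c P \<cdot>\<^sub>m P)" "j < dim_col (c P \<cdot>\<^sub>m P)"
    hence ij: "i < n" "j < n" using Pc by auto
    have "(mat_lincomb n c S * P) $$ (i, j) = (\<Sum>k<n. (\<Sum>Q\<in>S. c Q * Q $$ (i, k)) * P $$ (k, j))"
      using ij Pc by (simp add: mat_lincomb_def index_mult_mat_sum del: index_mult_mat(1))
    also have "\<dots> = (\<Sum>Q\<in>S. c Q * (\<Sum>k<n. Q $$ (i, k) * P $$ (k, j)))"
      unfolding sum_distrib_right sum_distrib_left by (subst sum.swap) (simp add: mult.assoc)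
    also have "\<dots> = (\<Sum>Q\<in>S. if Q = P then c P * P $$ (i, j) else 0)"
      by (intro sum.cong refl) (simp add: entry[OF _ P ij])
    finally show "(mat_lincomb n c S * P) $$ (i, j) = (c P \<cdot>\<^sub>m P) $$ (i, j)"
      using S(1) P ij Pc by simp
  qed (use L Pc in auto)
  show "P * mat_lincomb n c S = c P \<cdot>\<^sub>m P"
  proof (rule eq_matI)
    fix i j assume "i < dim_row (c P \<cdot>\<^sub>m P)" "j < dim_col (c P \<cdot>\<^sub>m P)"
    hence ij: "i < n" "j < n" using Pc by auto
    have "(P * mat_lincomb n c S) $$ (i, j) = (\<Sum>k<n. P $$ (i, k) * (\<Sum>Q\<in>S. c Q * Q $$ (k, j)))"
      using ij Pc by (simp add: mat_lincomb_def index_mult_mat_sum del: index_mult_mat(1))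
    also have "\<dots> = (\<Sum>Q\<in>S. c Q * (\<Sum>k<n. P $$ (i, k) * Q $$ (k, j)))"
      unfolding sum_distrib_left by (subst sum.swap) (simp add: mult.left_commute)
    also have "\<dots> = (\<Sum>Q\<in>S. if Q = P then c P * P $$ (i, j) else 0)"
      by (intro sum.cong refl) (simp add: entry[OF P _ ij])
    finally show "(P * mat_lincomb n c S) $$ (i, j) = (c P \<cdot>\<^sub>m P) $$ (i, j)"
      using S(1) P ij Pc by simp
  qed (use L Pc in auto)
qed

lemma smult_mat_cancel:
  fixes A :: "complex mat"
  assumes "A \<in> carrier_mat n m" "A \<noteq> 0\<^sub>m n m" "a \<cdot>\<^sub>m A = b \<cdot>\<^sub>m A"
  shows "a = b"
proof (rule ccontr)
  assume ab: "a \<noteq> b"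
  have "A $$ (i, j) = 0" if "i < n" "j < m" for i j
    using arg_cong[OF assms(3), of "\<lambda>Z. Z $$ (i, j)"] that assms(1) ab by simp
  hence "A = 0\<^sub>m n m" using assms(1) by (intro eq_matI) auto
  with assms(2) show False by blast
qed

text \<open>The canonical projections are the minimal nonzero idempotents of the context, which is
  a description that does not refer to them.\<close>

lemma canonical_projections_eq_minimal:
  assumes "canonical_projections n V S"
  shows "S = {P \<in> V. P \<noteq> 0\<^sub>m n n \<and> P * P = P \<and>
    (\<forall>Q\<in>V. Q * Q = Q \<longrightarrow> P * Q = P \<or> P * Q = 0\<^sub>m n n)}" (is "_ = ?M")
proof -
  have fin: "finite S" and V: "V = generated_by n S"
    and carr: "\<And>P. P \<in> S \<Longrightarrow> P \<in> carrier_mat n n" and idem: "\<And>P. P \<in> S \<Longrightarrow> P * P = P"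
    and nz: "\<And>P. P \<in> S \<Longrightarrow> P \<noteq> 0\<^sub>m n n"
    and orth: "\<And>P Q. P \<in> S \<Longrightarrow> Q \<in> S \<Longrightarrow> P \<noteq> Q \<Longrightarrow> P * Q = 0\<^sub>m n n"
    using assms unfolding canonical_projections_def projection_mat_def by auto
  note mult = mat_lincomb_mult_projection[OF fin carr idem orth]
  have mem: "P \<in> V" if P: "P \<in> S" for P
  proof -
    have "P = mat_lincomb n (\<lambda>Q. if Q = P then 1 else 0) S"
      using carr[OF P] fin P
      by (intro eq_matI)
        (simp_all add: mat_lincomb_def if_distrib[of "\<lambda>x. x * _"] cong: if_cong)
    thus ?thesis unfolding V generated_by_def by blast
  qed
  have zero_smult: "0\<^sub>m n n = (0 :: complex) \<cdot>\<^sub>m P" if "P \<in> carrier_mat n n" for P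
    using that by (intro eq_matI) auto
  show ?thesis
  proof (intro equalityI subsetI)
    fix P assume P: "P \<in> S"
    have "P * Q = P \<or> P * Q = 0\<^sub>m n n" if Q: "Q \<in> V" "Q * Q = Q" for Q
    proof -
      obtain c where c: "Q = mat_lincomb n c S" using Q(1) unfolding V generated_by_def by blast
      have Qc: "Q \<in> carrier_mat n n" unfolding c by (simp add: mat_lincomb_def)
      have PQ: "P * Q = c P \<cdot>\<^sub>m P" unfolding c by (rule mult(2)) (use P in auto)
      \<comment> \<open>Evaluating P Q Q in two ways shows that the coefficient of an idempotent at
        P equals its own square.\<close>
      have "c P \<cdot>\<^sub>m P = P * (Q * Q)" unfolding Q(2) PQ ..
      also have "\<dots> = (P * Q) * Q" by (rule mult_mat_assoc[symmetric]) (use carr[OF P] Qc in auto)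
      also have "\<dots> = (c P * c P) \<cdot>\<^sub>m P"
        unfolding PQ mult_smult_assoc_mat[OF carr[OF P] Qc] using carr[OF P] PQ
        by (intro eq_matI) (auto simp del: index_mult_mat(1))
      finally have "c P = c P * c P" by (rule smult_mat_cancel[OF carr[OF P] nz[OF P]])
      hence "c P = 0 \<or> c P = 1" by auto
      moreover have "1 \<cdot>\<^sub>m P = P" by (intro eq_matI) auto
      ultimately show ?thesis unfolding PQ using zero_smult[OF carr[OF P]] by auto
    qed
    thus "P \<in> ?M" using mem[OF P] nz[OF P] idem[OF P] by blast
  next
    fix P assume P: "P \<in> ?M"
    then obtain c where c: "P = mat_lincomb n c S" unfolding V generated_by_def by blast
    \<comment> \<open>Since P is nonzero, some coefficient is too. Minimality of P against that R
      gives P R = P, so P is a multiple of R, and idempotence makes the factor 1.\<close>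
    obtain R where R: "R \<in> S" "c R \<noteq> 0"
    proof (rule ccontr)
      assume "\<not> thesis"
      hence "c R = 0" if "R \<in> S" for R using that \<open>\<And>R. R \<in> S \<Longrightarrow> c R \<noteq> 0 \<Longrightarrow> thesis\<close> by blast
      hence "P = 0\<^sub>m n n" unfolding c by (intro eq_matI) (auto simp: mat_lincomb_def)
      with P show False by blast
    qed
    note Rc = carr[OF R(1)]
    have PR: "P * R = c R \<cdot>\<^sub>m R" unfolding c by (rule mult(1)) (use R in auto)
    have "P * R \<noteq> 0\<^sub>m n n"
    proof
      assume "P * R = 0\<^sub>m n n"
      hence "c R \<cdot>\<^sub>m R = 0 \<cdot>\<^sub>m R" unfolding PR zero_smult[OF Rc] .
      with smult_mat_cancel[OF Rc nz[OF R(1)]] R(2) show False by blast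
    qed
    hence "P * R = P" using P mem[OF R(1)] idem[OF R(1)] by blast
    hence PcR: "P = c R \<cdot>\<^sub>m R" using PR by simp
    have "(c R * c R) \<cdot>\<^sub>m R = c R \<cdot>\<^sub>m (P * R)" unfolding PR by (intro eq_matI) auto
    also have "\<dots> = P * (c R \<cdot>\<^sub>m R)"
      by (rule mult_smult_distrib[where nr = n, OF _ Rc, symmetric]) (simp add: c mat_lincomb_def)
    also have "\<dots> = P * P" unfolding PcR[symmetric] ..
    also have "\<dots> = c R \<cdot>\<^sub>m R" using P PcR by blast
    finally have "c R * c R = c R" by (rule smult_mat_cancel[OF Rc nz[OF R(1)]])
    hence "c R = 1" using R(2) by simp
    moreover have "1 \<cdot>\<^sub>m R = R" by (intro eq_matI) auto
    ultimately have "P = R" using PcR by simp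
    thus "P \<in> S" using R(1) by simp
  qed
qed

text \<open>The set of minimal idempotents depends on V alone, so any two candidates coincide and
  the \<open>THE\<close> in \<open>contextual_entropy\<close> is well defined.\<close>

lemma the_canonical_projections:
  "canonical_projections n V S \<Longrightarrow> (THE S. canonical_projections n V S) = S"
  by (rule the_equality) (use canonical_projections_eq_minimal in blast)+

section \<open>Maximal contexts as diagonal algebras\<close>

lemma range_unitary_diag_context:
  assumes n: "n \<ge> 2" and U: "isometry_mat n n U"
  shows "is_context n (range (unitary_diag n U))"
proof -
  note U' = isometry_matD(1)[OF U]
  have "range (unitary_diag n U) \<noteq> {c \<cdot>\<^sub>m 1\<^sub>m n | c. True}"
  proof
    \<comment> \<open>A scalar matrix has a constant diagonal; this one differs at the indices 0 and
      1, both below n because n >= 2.\<close>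
    let ?d = "\<lambda>i::nat. if i = 0 then 1 else 0 :: complex"
    assume "range (unitary_diag n U) = {c \<cdot>\<^sub>m 1\<^sub>m n | c. True}"
    then obtain c where "unitary_diag n U ?d = c \<cdot>\<^sub>m 1\<^sub>m n" by blast
    also have "\<dots> = unitary_diag n U (\<lambda>_. c)"
      unfolding unitary_diag_one[OF U, symmetric] unitary_diag_smult[OF U'] by simp
    finally have "unitary_diag n U ?d = unitary_diag n U (\<lambda>_. c)" .
    note eq = unitary_diag_inject[OF U this]
    have "?d 0 = ?d 1" using eq[of 0] eq[of 1] n by simp
    thus False by simp
  qed
  moreover have "1\<^sub>m n \<in> range (unitary_diag n U)"
    unfolding unitary_diag_one[OF U, symmetric] by simp
  ultimately show ?thesis
    unfolding is_context_def unital_star_subalgebra_def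
    by (auto simp: unitary_diag_carrier[OF U'] unitary_diag_add[OF U'] unitary_diag_smult[OF U']
        unitary_diag_mult[OF U] unitary_diag_adjoint[OF U'] mult.commute)
qed

lemma commute_unitary_diag:
  assumes U: "isometry_mat n n U" and A: "A \<in> carrier_mat n n"
    and comm: "\<And>d. A * unitary_diag n U d = unitary_diag n U d * A"
  shows "A \<in> range (unitary_diag n U)"
proof -
  note U' = isometry_matD[OF U]
  \<comment> \<open>A diagonal matrix with pairwise distinct entries: commuting with it makes (i -
    j) times the (i, j) entry vanish, which leaves only the diagonal.\<close>
  let ?D = "mat_diag n of_nat"
  have "compress U A * ?D = mat_adjoint U * ((A * unitary_diag n U of_nat) * U)"
    using U' A by (simp add: compress_def unitary_diag_def mult_mat_assoc right_mult_one_mat[of _ n n])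
  also have "\<dots> = mat_adjoint U * (U * (?D * compress U A))"
    unfolding comm using U'(2,3) A by (simp add: compress_def unitary_diag_def mult_mat_assoc)
  also have "\<dots> = ?D * compress U A" by (rule U'(5)) simp
  finally have eq: "compress U A * ?D = ?D * compress U A" .
  have "compress U A $$ (i, j) = 0" if ij: "i < n" "j < n" "i \<noteq> j" for i j
  proof -
    note C = compress_carrier[OF U'(1) A]
    from eq have "(compress U A * ?D) $$ (i, j) = (?D * compress U A) $$ (i, j)" by simp
    hence "compress U A $$ (i, j) * of_nat j = of_nat i * compress U A $$ (i, j)"
      unfolding mat_diag_mult_right[OF C] mat_diag_mult_left[OF C] using ij by simp
    thus ?thesis using ij by auto
  qed
  hence "compress U A = mat_diag n (\<lambda>i. compress U A $$ (i, i))"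
    using carrier_matD[OF compress_carrier[OF U'(1) A]]
    by (intro eq_matI) (auto simp: mat_diag_def)
  from unitary_diag_compress[OF U A this] show ?thesis by blast
qed

lemma range_unitary_diag_maximal:
  assumes "n \<ge> 2" "isometry_mat n n U"
  shows "maximal_context n (range (unitary_diag n U))"
  unfolding maximal_context_def
proof (intro conjI allI impI)
  show "is_context n (range (unitary_diag n U))" by (rule range_unitary_diag_context[OF assms])
  fix W assume W: "is_context n W" and sub: "range (unitary_diag n U) \<subseteq> W"
  have "W \<subseteq> range (unitary_diag n U)"
  proof
    fix A assume A: "A \<in> W"
    show "A \<in> range (unitary_diag n U)"
    proof (rule commute_unitary_diag[OF assms(2)])
      show "A \<in> carrier_mat n n"
        using A W unfolding is_context_def unital_star_subalgebra_def by blast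
      show "A * unitary_diag n U d = unitary_diag n U d * A" for d
        using A W sub unfolding is_context_def by blast
    qed
  qed
  with sub show "W = range (unitary_diag n U)" by blast
qed

lemma diagonalize_unitary_diag:
  assumes U: "isometry_mat n n U" and A: "A \<in> carrier_mat n n" and d: "A * U = U * mat_diag n d"
  shows "A = unitary_diag n U d"
proof (rule unitary_diag_compress[OF U A])
  show "compress U A = mat_diag n d"
    unfolding compress_def d by (rule isometry_matD(5)[OF U]) simp
qed

text \<open>Simultaneous diagonalization yields only an inclusion. The full diagonal algebra is
  itself a context, so maximality of V turns it into an equality.\<close>

lemma maximal_context_eq_range:
  assumes n: "n \<ge> 2" and V: "maximal_context n V"
  obtains U where "isometry_mat n n U" "V = range (unitary_diag n U)"
proof -
  have ctx: "is_context n V" using V unfolding maximal_context_def by blast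
  have carr: "V \<subseteq> carrier_mat n n"
    and comm: "\<And>A B. A \<in> V \<Longrightarrow> B \<in> V \<Longrightarrow> A * B = B * A"
    and star: "\<And>A. A \<in> V \<Longrightarrow> mat_adjoint A \<in> V"
    using ctx unfolding is_context_def unital_star_subalgebra_def by auto
  obtain U where U: "isometry_mat n n U" and diag: "\<And>A. A \<in> V \<Longrightarrow> \<exists>d. A * U = U * mat_diag n d"
    using simultaneous_diagonalization[OF carr comm star] by blast
  have "V \<subseteq> range (unitary_diag n U)"
    using diag diagonalize_unitary_diag[OF U] carr by blast
  hence "range (unitary_diag n U) = V"
    using V range_unitary_diag_context[OF n U] unfolding maximal_context_def by blast
  with that[OF U] show thesis by blast
qed

text \<open>This links matrix products with the inner products in which \<open>psd_mat\<close>,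
  \<open>mat_in_basis\<close> and \<open>orthonormal_basis\<close> are phrased.\<close>

lemma compress_index:
  assumes "U \<in> carrier_mat n n" "A \<in> carrier_mat n n" "i < n" "j < n"
  shows "compress U A $$ (i, j) = (A *\<^sub>v col U j) \<bullet>c col U i"
proof -
  have "row (mat_adjoint U) i = conjugate (col U i)"
    using assms by (intro eq_vecI) auto
  moreover have "col (A * U) j = A *\<^sub>v col U j"
    using assms by (intro col_mult2[of _ n n _ n]) auto
  ultimately have "compress U A $$ (i, j) = conjugate (col U i) \<bullet> (A *\<^sub>v col U j)"
    using assms by (simp add: compress_def)
  also have "\<dots> = (A *\<^sub>v col U j) \<bullet>c col U i"
    using assms by (intro comm_scalar_prod[of _ n]) auto
  finally show ?thesis .
qed

lemma orthonormal_basis_iff_isometry: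
  "orthonormal_basis n (col U) \<longleftrightarrow> isometry_mat n n U" if U: "U \<in> carrier_mat n n"
proof -
  have one: "1\<^sub>m n *\<^sub>v col U i = col U i" if "i < n" for i
    using that U by simp
  have cmp: "compress U (1\<^sub>m n) = mat_adjoint U * U" using U by (simp add: compress_def)
  have "(mat_adjoint U * U) $$ (i, j) = col U j \<bullet>c col U i" if "i < n" "j < n" for i j
    using compress_index[OF U one_carrier_mat that] one[OF that(2)] by (simp add: cmp)
  hence "mat_adjoint U * U = 1\<^sub>m n \<longleftrightarrow>
      (\<forall>i<n. \<forall>j<n. col U j \<bullet>c col U i = (if i = j then 1 else 0))"
    using U by (auto simp: mat_eq_iff simp del: index_mult_mat(1))
  thus ?thesis using U unfolding orthonormal_basis_def isometry_mat_def by auto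
qed

section \<open>Entropy\<close>

lemma contextual_entropy_unitary:
  assumes "isometry_mat n n U" "\<rho> \<in> carrier_mat n n"
  shows "contextual_entropy n \<rho> (range (unitary_diag n U)) =
    - (\<Sum>i<n. xlnx (Re (compress U \<rho> $$ (i, i))))"
proof -
  note U = isometry_matD[OF assms(1)]
  have "mat_trace (\<rho> * vec_projection (col U i)) = compress U \<rho> $$ (i, i)" if i: "i < n" for i
  proof -
    let ?D = "mat_diag n (\<lambda>j. if j = i then 1 else 0)"
    \<comment> \<open>The projection is U E U^H with E the i-th diagonal matrix unit; cycling the
      trace leaves Tr(E U^H \<rho> U), a single diagonal entry.\<close>
    have "\<rho> * vec_projection (col U i) = (\<rho> * U) * (?D * mat_adjoint U)"
      unfolding vec_projection_col[OF U(1) i] unitary_diag_def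
      using U(2,3) assms(2) by (simp add: mult_mat_assoc)
    hence "mat_trace (\<rho> * vec_projection (col U i)) = mat_trace ((?D * mat_adjoint U) * (\<rho> * U))"
      using U(2,3) assms(2) by (simp add: mat_trace_mult_comm)
    also have "(?D * mat_adjoint U) * (\<rho> * U) = ?D * compress U \<rho>"
      using U(2,3) assms(2) by (simp add: mult_mat_assoc compress_def)
    also have "mat_trace \<dots> = (\<Sum>j<n. (if j = i then 1 else 0) * compress U \<rho> $$ (j, j))"
      unfolding mat_diag_mult_left[OF compress_carrier[OF U(1) assms(2)]]
      by (simp add: mat_trace_def)
    also have "\<dots> = compress U \<rho> $$ (i, i)"
      using i by (simp add: if_distrib[of "\<lambda>x. x * _"] cong: if_cong)
    finally show ?thesis .
  qed
  thus ?thesis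
    unfolding contextual_entropy_def the_canonical_projections[OF canonical_column_projections[OF assms(1)]]
    by (simp add: column_projections_def sum.reindex[OF inj_on_column_projections[OF assms(1)]])
qed

lemma density_diag_nonneg:
  assumes "density_mat n \<rho>" "isometry_mat n n U" "i < n"
  shows "0 \<le> compress U \<rho> $$ (i, i)"
proof -
  note U = isometry_matD[OF assms(2)]
  have "col U i \<in> carrier_vec n" by (rule carrier_vecI) (simp add: U(2))
  hence "\<rho> \<in> carrier_mat n n" "0 \<le> (\<rho> *\<^sub>v col U i) \<bullet>c col U i"
    using assms(1) unfolding density_mat_def psd_mat_def by blast+
  thus ?thesis using compress_index[OF U(1) _ assms(3,3)] by simp
qed

text \<open>Similarity preserves the characteristic polynomial. That of a diagonal matrix is a
  product of linear factors, so its multiset of roots lists the diagonal with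
  multiplicities.\<close>

lemma von_neumann_entropy_diagonal:
  assumes U: "isometry_mat n n U" and \<rho>: "\<rho> = unitary_diag n U d"
  shows "von_neumann_entropy \<rho> = - (\<Sum>i<n. xlnx (Re (d i)))"
proof -
  note U' = isometry_matD[OF U]
  have "similar_mat \<rho> (mat_diag n d)"
  proof (rule similar_matI)
    show "{\<rho>, mat_diag n d, U, mat_adjoint U} \<subseteq> carrier_mat n n"
      using U'(1) unitary_diag_carrier[OF U'(1)] \<rho> by auto
    show "U * mat_adjoint U = 1\<^sub>m n" by (rule isometry_mat_le(2)[OF U refl])
    show "\<rho> = U * mat_diag n d * mat_adjoint U"
      unfolding \<rho> unitary_diag_def using U'(2,3) by (simp add: mult_mat_assoc)
  qed (rule U'(4))
  hence "char_poly \<rho> = char_poly (mat_diag n d)" by (rule char_poly_similar)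
  also have "\<dots> = (\<Prod>a\<leftarrow>diag_mat (mat_diag n d). [:- a, 1:])"
    by (rule char_poly_upper_triangular[of _ n]) (auto simp: mat_diag_def)
  also have "diag_mat (mat_diag n d) = map d [0..<n]"
    by (auto simp: diag_mat_def mat_diag_def)
  finally have "char_poly \<rho> = (\<Prod>i\<in>{..<n}. [:- d i, 1:])"
    using prod.distinct_set_conv_list[of "[0..<n]" "\<lambda>i. [:- d i, 1:]"]
    by (simp add: lessThan_atLeast0 o_def)
  hence "proots (char_poly \<rho>) = (\<Sum>i\<in>{..<n}. {#d i#})"
    by (simp add: proots_prod)
  also have "\<dots> = image_mset d (mset_set {..<n})"
    by (induction n) (simp_all add: lessThan_Suc)
  finally show ?thesis unfolding von_neumann_entropy_def
    by (simp add: sum_unfold_sum_mset multiset.map_comp o_def)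
qed

section \<open>Convexity of x ln x\<close>

lemma xlnx_tangent:
  assumes "x \<ge> 0" "y > 0"
  shows "xlnx y + (ln y + 1) * (x - y) \<le> xlnx x"
proof (cases "x = 0")
  case False
  hence x: "x > 0" using assms by simp
  have "ln (y / x) \<le> y / x - 1" using x assms by (intro ln_le_minus_one) simp
  hence "x * (ln y - ln x) \<le> x * (y / x - 1)"
    using x assms by (intro mult_left_mono) (simp_all add: ln_div)
  thus ?thesis using x by (simp add: xlnx_def algebra_simps)
qed (use assms in \<open>simp add: xlnx_def algebra_simps\<close>)

text \<open>Averaging the tangent inequality at the mean y makes the linear term cancel.\<close>

lemma xlnx_jensen:
  assumes "finite I" "\<And>i. i \<in> I \<Longrightarrow> 0 \<le> p i" "sum p I = 1" "\<And>i. i \<in> I \<Longrightarrow> 0 \<le> x i"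
  shows "xlnx (\<Sum>i\<in>I. p i * x i) \<le> (\<Sum>i\<in>I. p i * xlnx (x i))"
proof -
  define y where "y = (\<Sum>i\<in>I. p i * x i)"
  have "y \<ge> 0" unfolding y_def using assms by (intro sum_nonneg) auto
  show ?thesis
  proof (cases "y = 0")
    \<comment> \<open>There is no finite tangent at 0, but here every \<open>p i * x i\<close> is 0,
      and hence so is every \<open>p i * xlnx (x i)\<close>.\<close>
    case True
    hence "\<forall>i\<in>I. p i * x i = 0"
      unfolding y_def using assms by (subst (asm) sum_nonneg_eq_0_iff) auto
    hence "(\<Sum>i\<in>I. p i * xlnx (x i)) = 0"
      by (intro sum.neutral) (auto simp: xlnx_def)
    thus ?thesis using True by (simp add: y_def xlnx_def)
  next
    case False
    with \<open>y \<ge> 0\<close> have y: "y > 0" by simp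
    have "xlnx y = (\<Sum>i\<in>I. p i * (xlnx y + (ln y + 1) * (x i - y)))"
    proof -
      have "(\<Sum>i\<in>I. p i * (xlnx y + (ln y + 1) * (x i - y))) =
          (\<Sum>i\<in>I. (xlnx y - (ln y + 1) * y) * p i + (ln y + 1) * (p i * x i))"
        by (intro sum.cong) (auto simp: algebra_simps)
      also have "\<dots> = (xlnx y - (ln y + 1) * y) * sum p I + (ln y + 1) * y"
        by (simp only: sum.distrib sum_distrib_left y_def)
      finally show ?thesis using assms(3) by simp
    qed
    also have "\<dots> \<le> (\<Sum>i\<in>I. p i * xlnx (x i))"
      using assms xlnx_tangent[OF _ y] by (intro sum_mono mult_left_mono) auto
    finally show ?thesis by (simp add: y_def)
  qed
qed

text \<open>The diagonals of two unitary conjugates of \<open>\<rho>\<close>, one of them diagonal, are related by the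
  doubly stochastic matrix of squared moduli of the transition matrix.\<close>

lemma sum_xlnx_compress_le:
  assumes U: "isometry_mat n n U" and W: "isometry_mat n n W" and \<rho>: "\<rho> = unitary_diag n U d"
    and nonneg: "\<And>i. i < n \<Longrightarrow> 0 \<le> d i"
  shows "(\<Sum>i<n. xlnx (Re (compress W \<rho> $$ (i, i)))) \<le> (\<Sum>i<n. xlnx (Re (d i)))"
proof -
  note U' = isometry_matD[OF U] and W' = isometry_matD[OF W]
  \<comment> \<open>The transition matrix between the two bases: W^H \<rho> W = T D T^H, so its
    diagonal entries are averages of d with the weights |T_ij|^2.\<close>
  define T where "T = mat_adjoint W * U"
  have T: "T \<in> carrier_mat n n" using U' W' by (simp add: T_def)
  have "isometry_mat n n (mat_adjoint W)"
    using W' isometry_mat_le(2)[OF W refl] by (simp add: isometry_mat_def)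
  hence Tiso: "isometry_mat n n T" unfolding T_def using U by (rule isometry_mat_mult)
  define p where "p i j = (cmod (T $$ (i, j)))\<^sup>2" for i j
  have rows: "(\<Sum>j<n. p i j) = 1" if i: "i < n" for i
  proof -
    have "complex_of_real (\<Sum>j<n. p i j) = (T * mat_adjoint T) $$ (i, i)"
      using i T
      by (simp add: p_def index_mult_mat_sum complex_norm_square del: index_mult_mat(1) of_real_power)
    also have "\<dots> = 1" using isometry_mat_le(2)[OF Tiso refl] i by simp
    finally show ?thesis by (simp only: of_real_eq_1_iff)
  qed
  have cols: "(\<Sum>i<n. p i j) = 1" if j: "j < n" for j
  proof -
    have "complex_of_real (\<Sum>i<n. p i j) = (mat_adjoint T * T) $$ (j, j)"
      using j T
      by (simp add: p_def index_mult_mat_sum complex_norm_square mult.commute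
          del: index_mult_mat(1) of_real_power)
    also have "\<dots> = 1" using isometry_matD(4)[OF Tiso] j by simp
    finally show ?thesis by (simp only: of_real_eq_1_iff)
  qed
  have "compress W \<rho> = unitary_diag n T d"
    unfolding \<rho> compress_def unitary_diag_def T_def
    using U'(2,3) W'(2,3) by (simp add: mat_adjoint_mult mult_mat_assoc)
  hence entry: "Re (compress W \<rho> $$ (i, i)) = (\<Sum>j<n. p i j * Re (d j))" if i: "i < n" for i
    using unitary_diag_index[OF T i i, of d] by (simp add: p_def mult.commute del: of_real_power flip: complex_norm_square)
  have "(\<Sum>i<n. xlnx (Re (compress W \<rho> $$ (i, i)))) \<le> (\<Sum>i<n. \<Sum>j<n. p i j * xlnx (Re (d j)))"
  proof (rule sum_mono)
    fix i assume "i \<in> {..<n}"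
    hence i: "i < n" by simp
    show "xlnx (Re (compress W \<rho> $$ (i, i))) \<le> (\<Sum>j<n. p i j * xlnx (Re (d j)))"
      unfolding entry[OF i]
      by (rule xlnx_jensen) (use rows[OF i] nonneg in \<open>auto simp: p_def less_eq_complex_def\<close>)
  qed
  also have "\<dots> = (\<Sum>j<n. \<Sum>i<n. p i j * xlnx (Re (d j)))" by (rule sum.swap)
  also have "\<dots> = (\<Sum>j<n. (\<Sum>i<n. p i j) * xlnx (Re (d j)))" by (simp only: sum_distrib_right)
  \<comment> \<open>Row sums served as Jensen weights; after the exchange of summation the column
    sums collapse the total.\<close>
  also have "\<dots> = (\<Sum>j<n. xlnx (Re (d j)))" by (intro sum.cong) (auto simp: cols)
  finally show ?thesis .
qed

section \<open>The minimum over maximal contexts\<close>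

lemma contextual_entropy_eigenbasis:
  assumes "isometry_mat n n U" "\<rho> = unitary_diag n U d"
  shows "contextual_entropy n \<rho> (range (unitary_diag n U)) = von_neumann_entropy \<rho>"
proof -
  have "\<rho> \<in> carrier_mat n n"
    unfolding assms(2) by (rule unitary_diag_carrier[OF isometry_matD(1)[OF assms(1)]])
  moreover have "compress U \<rho> $$ (i, i) = d i" if "i < n" for i
    unfolding assms(2) compress_unitary_diag[OF assms(1)] using that by (simp add: mat_diag_def)
  ultimately show ?thesis
    by (simp add: contextual_entropy_unitary[OF assms(1)] von_neumann_entropy_diagonal[OF assms])
qed

theorem mainTheorem2:
  fixes n :: nat and \<rho> :: "complex mat"
  assumes "n \<ge> 2"
    and "density_mat n \<rho>"
  shows "(\<forall>u V. orthonormal_basis n u \<and> diagonal_mat (mat_in_basis n u \<rho>) \<and>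
             maximal_context n V \<and> V = generated_by n ((\<lambda>i. vec_projection (u i)) ` {..<n}) \<longrightarrow>
             contextual_entropy n \<rho> V = von_neumann_entropy \<rho>) \<and>
         (\<exists>V. maximal_context n V \<and> contextual_entropy n \<rho> V = von_neumann_entropy \<rho>) \<and>
         (\<forall>V. maximal_context n V \<longrightarrow> von_neumann_entropy \<rho> \<le> contextual_entropy n \<rho> V)"
proof (intro conjI allI impI)
  have \<rho>c: "\<rho> \<in> carrier_mat n n" and herm: "mat_adjoint \<rho> = \<rho>"
    using assms(2) unfolding density_mat_def psd_mat_def hermitian_mat_def by blast+
  \<comment> \<open>As \<rho> is Hermitian, {\<rho>} is a commuting family closed under adjoints, so
    the spectral theorem is an instance.\<close>
  obtain U where U: "isometry_mat n n U" and "\<exists>d. \<rho> * U = U * mat_diag n d"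
    by (rule simultaneous_diagonalization[of "{\<rho>}" n]) (use \<rho>c herm in blast)+
  then obtain d where \<rho>: "\<rho> = unitary_diag n U d"
    using diagonalize_unitary_diag[OF U \<rho>c] by blast
  show "\<exists>V. maximal_context n V \<and> contextual_entropy n \<rho> V = von_neumann_entropy \<rho>"
    using range_unitary_diag_maximal[OF assms(1) U] contextual_entropy_eigenbasis[OF U \<rho>] by blast
  show "von_neumann_entropy \<rho> \<le> contextual_entropy n \<rho> V" if V: "maximal_context n V" for V
  proof -
    obtain W where W: "isometry_mat n n W" and VW: "V = range (unitary_diag n W)"
      by (rule maximal_context_eq_range[OF assms(1) V])
    have "0 \<le> d i" if "i < n" for i
      using density_diag_nonneg[OF assms(2) U that] that
      by (simp add: \<rho> compress_unitary_diag[OF U] mat_diag_def)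
    from sum_xlnx_compress_le[OF U W \<rho> this] show ?thesis
      unfolding VW contextual_entropy_unitary[OF W \<rho>c] von_neumann_entropy_diagonal[OF U \<rho>] by simp
  qed
  fix u V
  assume asm: "orthonormal_basis n u \<and> diagonal_mat (mat_in_basis n u \<rho>) \<and>
    maximal_context n V \<and> V = generated_by n ((\<lambda>i. vec_projection (u i)) ` {..<n})"
  \<comment> \<open>The given basis, packed as the columns of a matrix, takes the place of U. It may
    list the eigenvalues in another order, which does not affect the entropy.\<close>
  define B where "B = mat n n (\<lambda>(i, j). u j $ i)"
  have Bc: "B \<in> carrier_mat n n" by (simp add: B_def)
  have col: "col B i = u i" if "i < n" for i
    using asm that unfolding orthonormal_basis_def by (intro eq_vecI) (auto simp: B_def)
  have B: "isometry_mat n n B"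
    using asm orthonormal_basis_iff_isometry[OF Bc] by (simp add: orthonormal_basis_def col)
  have "mat_in_basis n u \<rho> = compress B \<rho>"
    using carrier_matD[OF compress_carrier[OF Bc \<rho>c]]
    by (intro eq_matI) (simp_all add: mat_in_basis_def compress_index[OF Bc \<rho>c] col)
  hence "compress B \<rho> = mat_diag n (\<lambda>i. compress B \<rho> $$ (i, i))"
    using asm carrier_matD[OF compress_carrier[OF Bc \<rho>c]]
    by (intro eq_matI) (auto simp: mat_diag_def diagonal_mat_def)
  note \<rho>B = unitary_diag_compress[OF B \<rho>c this]
  have "V = range (unitary_diag n B)"
    using asm generated_by_column_projections[OF B]
    by (simp add: column_projections_def col cong: image_cong_simp)
  thus "contextual_entropy n \<rho> V = von_neumann_entropy \<rho>"
    using contextual_entropy_eigenbasis[OF B \<rho>B] by simp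
qed

end
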